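(* Let $\Omega\subseteq\mathbb{C}$ be a domain and let $$\mathcal{L}(\lambda)=\begin{pmatrix}A(\lambda)&B(\lambda)\\C(\lambda)&D(\lambda)\end{pmatrix},\quad\operatorname{dom}\mathcal{L}(\lambda)=\big(\operatorname{dom}A(\lambda)\cap\operatorname{dom}C(\lambda)\big)\oplus\big(\operatorname{dom}B(\lambda)\cap\operatorname{dom}D(\lambda)\big),\quad\lambda\in\Omega,$$ be a family of operator matrices in $\mathcal{H}=\mathcal{H}_1\oplus\mathcal{H}_2$ with Schur complements $S_1,S_2$. In the following, $\pm$ and $\mp$ are to be read with either the upper signs throughout or the lower signs throughout. (i) If $\lambda\in\sigma_{\mathrm{ap}}(\mathcal{L})\setminus\sigma(D)$ is such that $C(\lambda)\subseteq\pm B(\lambda)^*$, $A(\lambda)$ is accretive, $\mp D(\lambda)$ is sectorial with vertex $0$ and $B(\lambda)$ is $D(\lambda)$-bounded, then $\lambda\in\sigma_{\mathrm{ap}}(S_1)\cup W_\Psi(D)$. If these conditions (on $A(\lambda),B(\lambda),C(\lambda),D(\lambda)$) hold for all $\lambda\in\rho(D)$, then $$\sigma_{\mathrm{ap}}(\mathcal{L})\setminus\sigma(D)\subseteq\sigma_{\mathrm{ap}}(S_1)\cup W_\Psi(D)\subseteq W_\Psi(S_1)\cup W_\Psi(D);$$ if, moreover, $\dim\mathcal{H}_1>1$, then $$\sigma_{\mathrm{ap}}(\mathcal{L})\setminus\sigma(D)\subseteq W^2_{\Psi,2}(\mathcal{L})\subseteq W^2_\Psi(\mathcal{L}).$$ (ii)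 If $\lambda\in\sigma_{\mathrm{ap}}(\mathcal{L})\setminus\sigma(A)$ is such that $C(\lambda)\subseteq\pm B(\lambda)^*$, $A(\lambda)$ is sectorial with vertex $0$, $\mp D(\lambda)$ is accretive and $C(\lambda)$ is $A(\lambda)$-bounded, then $\lambda\in\sigma_{\mathrm{ap}}(S_2)\cup W_\Psi(A)$. If these conditions hold for all $\lambda\in\rho(A)$, then $$\sigma_{\mathrm{ap}}(\mathcal{L})\setminus\sigma(A)\subseteq\sigma_{\mathrm{ap}}(S_2)\cup W_\Psi(A)\subseteq W_\Psi(S_2)\cup W_\Psi(A);$$ if, moreover, $\dim\mathcal{H}_2>1$, then $$\sigma_{\mathrm{ap}}(\mathcal{L})\setminus\sigma(A)\subseteq W^2_{\Psi,2}(\mathcal{L})\subseteq W^2_\Psi(\mathcal{L}).$$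
   Context: $\mathcal{H}_1,\mathcal{H}_2$ are nonzero complex Hilbert spaces. Each $\mathcal{L}(\lambda)$ is densely defined, and $A(\lambda)$ in $\mathcal{H}_1$, $B(\lambda)$ from $\mathcal{H}_2$ to $\mathcal{H}_1$, $C(\lambda)$ from $\mathcal{H}_1$ to $\mathcal{H}_2$, $D(\lambda)$ in $\mathcal{H}_2$ are densely defined closable linear operators (no holomorphy in $\lambda$ is assumed). Write $\mathcal{D}_1(\lambda)=\operatorname{dom}A(\lambda)\cap\operatorname{dom}C(\lambda)$, $\mathcal{D}_2(\lambda)=\operatorname{dom}B(\lambda)\cap\operatorname{dom}D(\lambda)$. An operator $T$ is accretive if $\operatorname{Re}(Tf,f)\ge0$ for all $f\in\operatorname{dom}T$; it is sectorial with vertex $0$ if there is $\omega\in[0,\pi/2)$ with $(Tf,f)\in\{z:|\arg z|\le\omega\}$ for all $f\in\operatorname{dom}T$ (with $\arg0=0$). $S$ is $T$-bounded if $\operatorname{dom}T\subseteq\operatorname{dom}S$ and there are $a,b\ge0$ with $\|Sx\|\le a\|x\|+b\|Tx\|$, $x\in\operatorname{dom}T$. For an operator family $T(\lambda)$, $\lambda\in\Omega'$, on a set $\Omega'\subseteq\mathbb{C}$: $\sigma(T)=\{\lambda\in\Omega':0\in\sigma(T(\lambda))\}$, $\rho(T)=\Omega'\setminus\sigma(T)$, $\sigma_{\mathrm{ap}}(T)=\{\lambda\in\Omega':\exists(f_n)_n\subseteq\operatorname{dom}T(\lambda),\|f_n\|=1,T(\lambda)f_n\to0\}$, $W(T)=\{\lambda\in\Omega':\exists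 f\in\operatorname{dom}T(\lambda),f\ne0,(T(\lambda)f,f)=0\}$, and the pseudo numerical range is $W_\Psi(T)=\bigcap_{\varepsilon>0}\bigcup_{B\ \text{bounded},\|B\|<\varepsilon}W(T+B)$. Schur complements: $S_1(\lambda)=A(\lambda)-B(\lambda)D(\lambda)^{-1}C(\lambda)$, $\operatorname{dom}S_1(\lambda)=\{f\in\mathcal{D}_1(\lambda):D(\lambda)^{-1}C(\lambda)f\in\operatorname{dom}B(\lambda)\}$, for $\lambda\in\rho(D)$ (family on $\rho(D)$); $S_2(\lambda)=D(\lambda)-C(\lambda)A(\lambda)^{-1}B(\lambda)$, $\operatorname{dom}S_2(\lambda)=\{f\in\mathcal{D}_2(\lambda):A(\lambda)^{-1}B(\lambda)f\in\operatorname{dom}C(\lambda)\}$, for $\lambda\in\rho(A)$ (family on $\rho(A)$). Quadratic numerical range: $W^2(\mathcal{L})$ is the set of $\lambda\in\Omega$ for which there are unit vectors $f\in\mathcal{D}_1(\lambda)$, $g\in\mathcal{D}_2(\lambda)$ with $\det\begin{pmatrix}(A(\lambda)f,f)&(B(\lambda)g,f)\\(C(\lambda)f,g)&(D(\lambda)g,g)\end{pmatrix}=0$. Pseudo quadratic numerical range: $W^2_\Psi(\mathcal{L})=\bigcap_{\varepsilon>0}\bigcup_{\mathcal{B}\in L(\mathcal{H}),\|\mathcal{B}\|<\varepsilon}W^2(\mathcal{L}+\mathcal{B})$. Further, $W^2_{\Psi,2}(\mathcal{L})=\bigcap_{\varepsilon>0}\bigcup_{B_i\in L(\mathcal{H}_i),\|B_i\|<\varepsilon}W^2(\mathcal{L}+\operatorname{diag}(B_1,B_2))$.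 *)

theory Defs
  imports "HOL-Analysis.Analysis"
begin

section \<open>Complex Hilbert spaces\<close>

text \<open>A complex vector space is a real vector space whose real scalar multiplication is the
  restriction of a complex one; a complex inner product space is a real inner product space whose
  real inner product is the real part of a complex one. In this way norm, topology, completeness
  and the Hilbert sum \<^typ>\<open>'a \<times> 'b\<close> are those of the library.\<close>

class complex_vector = real_vector +
  fixes scaleC :: "complex \<Rightarrow> 'a \<Rightarrow> 'a"
  assumes scaleC_add_right: "scaleC c (x + y) = scaleC c x + scaleC c y"
    and scaleC_add_left: "scaleC (c + d) x = scaleC c x + scaleC d x"
    and scaleC_scaleC: "scaleC c (scaleC d x) = scaleC (c * d) x"
    and scaleR_eq_scaleC: "scaleR r x = scaleC (complex_of_real r) x"
begin

lemma scaleC_one: "scaleC 1 x = x"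
  using scaleR_eq_scaleC[of 1 x] scaleR_one[of x] by simp

end

interpretation cvec: vector_space "scaleC :: complex \<Rightarrow> 'a \<Rightarrow> 'a::complex_vector"
  by unfold_locales (simp_all add: scaleC_add_right scaleC_add_left scaleC_scaleC scaleC_one)

text \<open>The inner product is linear in the first argument.\<close>

class complex_inner = complex_vector + real_inner +
  fixes cinner :: "'a \<Rightarrow> 'a \<Rightarrow> complex"
  assumes cinner_commute: "cinner x y = cnj (cinner y x)"
    and cinner_add_left: "cinner (x + y) z = cinner x z + cinner y z"
    and cinner_scaleC_left: "cinner (scaleC c x) y = c * cinner x y"
    and inner_eq_Re_cinner: "inner x y = Re (cinner x y)"

class complex_hilbert = complex_inner + complete_space

instantiation prod :: (complex_vector, complex_vector) complex_vector
begin

definition scaleC_prod :: "complex \<Rightarrow> 'a \<times> 'b \<Rightarrow> 'a \<times> 'b" where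
  "scaleC_prod c x = (scaleC c (fst x), scaleC c (snd x))"

instance
  by intro_classes
    (auto simp: scaleC_prod_def scaleC_add_right scaleC_add_left scaleC_scaleC scaleR_prod_def
      scaleR_eq_scaleC)

end

instantiation prod :: (complex_inner, complex_inner) complex_inner
begin

definition cinner_prod :: "'a \<times> 'b \<Rightarrow> 'a \<times> 'b \<Rightarrow> complex" where
  "cinner_prod x y = cinner (fst x) (fst y) + cinner (snd x) (snd y)"

instance
proof
  fix x y z :: "'a \<times> 'b" and c :: complex
  show "cinner x y = cnj (cinner y x)"
    unfolding cinner_prod_def complex_cnj_add
    by (metis cinner_commute)
  show "cinner (x + y) z = cinner x z + cinner y z"
    by (simp add: cinner_prod_def cinner_add_left)
  show "cinner (scaleC c x) y = c * cinner x y"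
    by (simp add: cinner_prod_def scaleC_prod_def cinner_scaleC_left algebra_simps)
  show "inner x y = Re (cinner x y)"
    by (simp add: cinner_prod_def inner_prod_def inner_eq_Re_cinner)
qed

end

instance prod :: (complex_hilbert, complex_hilbert) complex_hilbert ..

text \<open>The library's \<^term>\<open>dim\<close> is \<^term>\<open>0::nat\<close> on infinite-dimensional spaces, hence the
  following dimension with values in the extended natural numbers.\<close>

definition cdim :: "'a::complex_vector itself \<Rightarrow> enat" where
  "cdim _ = (SUP S\<in>{S :: 'a set. finite S \<and> cvec.independent S}. enat (card S))"

definition bounded_clinear :: "('a::complex_inner \<Rightarrow> 'b::complex_inner) \<Rightarrow> bool" where
  "bounded_clinear T \<longleftrightarrow> bounded_linear T \<and> (\<forall>c x. T (scaleC c x) = scaleC c (T x))"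

section \<open>Unbounded operators\<close>

text \<open>An operator is a domain together with a map; the values of the map outside the domain are
  irrelevant, and nothing below depends on them.\<close>

datatype ('a, 'b) oper = Oper (opdom: "'a set") (opapp: "'a \<Rightarrow> 'b")

definition op_linear :: "('a::complex_inner, 'b::complex_inner) oper \<Rightarrow> bool" where
  "op_linear T \<longleftrightarrow> cvec.subspace (opdom T) \<and>
     (\<forall>x\<in>opdom T. \<forall>y\<in>opdom T. opapp T (x + y) = opapp T x + opapp T y) \<and>
     (\<forall>c. \<forall>x\<in>opdom T. opapp T (scaleC c x) = scaleC c (opapp T x))"

definition densely_defined :: "('a::complex_inner, 'b::complex_inner) oper \<Rightarrow> bool" where
  "densely_defined T \<longleftrightarrow> closure (opdom T) = UNIV"

definition closable :: "('a::complex_inner, 'b::complex_inner) oper \<Rightarrow> bool" where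
  "closable T \<longleftrightarrow> (\<forall>x y. (\<forall>n. x n \<in> opdom T) \<longrightarrow> x \<longlonglongrightarrow> 0 \<longrightarrow> (\<lambda>n. opapp T (x n)) \<longlonglongrightarrow> y \<longrightarrow> y = 0)"

definition op_subset :: "('a::complex_inner, 'b::complex_inner) oper \<Rightarrow> ('a, 'b) oper \<Rightarrow> bool" where
  "op_subset S T \<longleftrightarrow> opdom S \<subseteq> opdom T \<and> (\<forall>x\<in>opdom S. opapp S x = opapp T x)"

definition op_scale :: "complex \<Rightarrow> ('a::complex_inner, 'b::complex_inner) oper \<Rightarrow> ('a, 'b) oper" where
  "op_scale c T = Oper (opdom T) (\<lambda>x. scaleC c (opapp T x))"

text \<open>The sum of an operator and an everywhere defined one.\<close>

definition op_plus :: "('a::complex_inner, 'b::complex_inner) oper \<Rightarrow> ('a \<Rightarrow> 'b) \<Rightarrow> ('a, 'b) oper" where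
  "op_plus T M = Oper (opdom T) (\<lambda>x. opapp T x + M x)"

text \<open>For densely defined \<^term>\<open>T\<close> the vector \<^term>\<open>h\<close> below is unique.\<close>

definition op_adj :: "('a::complex_inner, 'b::complex_inner) oper \<Rightarrow> ('b, 'a) oper" where
  "op_adj T = Oper {f. \<exists>h. \<forall>g\<in>opdom T. cinner (opapp T g) f = cinner g h}
     (\<lambda>f. THE h. \<forall>g\<in>opdom T. cinner (opapp T g) f = cinner g h)"

text \<open>Only used when \<^term>\<open>T\<close> maps its domain bijectively onto the whole space.\<close>

definition op_inv :: "('a, 'b) oper \<Rightarrow> 'b \<Rightarrow> 'a" where
  "op_inv T = the_inv_into (opdom T) (opapp T)"

definition op_resolvent_set :: "('a::complex_inner, 'a) oper \<Rightarrow> complex set" where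
  "op_resolvent_set T = {z. let S = op_plus T (\<lambda>x. - scaleC z x) in
     bij_betw (opapp S) (opdom S) UNIV \<and> bounded_clinear (op_inv S)}"

definition op_spectrum :: "('a::complex_inner, 'a) oper \<Rightarrow> complex set" where
  "op_spectrum T = - op_resolvent_set T"

definition accretive :: "('a::complex_inner, 'a) oper \<Rightarrow> bool" where
  "accretive T \<longleftrightarrow> (\<forall>f\<in>opdom T. 0 \<le> Re (cinner (opapp T f) f))"

definition sectorial0 :: "('a::complex_inner, 'a) oper \<Rightarrow> bool" where
  "sectorial0 T \<longleftrightarrow>
     (\<exists>\<omega>. 0 \<le> \<omega> \<and> \<omega> < pi / 2 \<and> (\<forall>f\<in>opdom T. \<bar>Arg (cinner (opapp T f) f)\<bar> \<le> \<omega>))"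

text \<open>\<^term>\<open>rel_bounded S T\<close>: the operator \<^term>\<open>S\<close> is \<^term>\<open>T\<close>-bounded.\<close>

definition rel_bounded ::
    "('a::complex_inner, 'b::complex_inner) oper \<Rightarrow> ('a, 'c::complex_inner) oper \<Rightarrow> bool" where
  "rel_bounded S T \<longleftrightarrow> opdom T \<subseteq> opdom S \<and>
     (\<exists>a\<ge>0. \<exists>b\<ge>0. \<forall>x\<in>opdom T. norm (opapp S x) \<le> a * norm x + b * norm (opapp T x))"

section \<open>Operator families\<close>

text \<open>A family is a function on \<^typ>\<open>complex\<close> together with its parameter set \<^term>\<open>\<Omega>\<close>, passed
  separately; its values outside \<^term>\<open>\<Omega>\<close> are irrelevant.\<close>

definition fam_spectrum :: "complex set \<Rightarrow> (complex \<Rightarrow> ('a::complex_inner, 'a) oper) \<Rightarrow> complex set" where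
  "fam_spectrum \<Omega> T = {z\<in>\<Omega>. 0 \<in> op_spectrum (T z)}"

definition fam_resolvent :: "complex set \<Rightarrow> (complex \<Rightarrow> ('a::complex_inner, 'a) oper) \<Rightarrow> complex set" where
  "fam_resolvent \<Omega> T = \<Omega> - fam_spectrum \<Omega> T"

definition fam_ap_spectrum :: "complex set \<Rightarrow> (complex \<Rightarrow> ('a::complex_inner, 'a) oper) \<Rightarrow> complex set" where
  "fam_ap_spectrum \<Omega> T = {z\<in>\<Omega>. \<exists>f. (\<forall>n. f n \<in> opdom (T z) \<and> norm (f n) = 1) \<and>
     (\<lambda>n. opapp (T z) (f n)) \<longlonglongrightarrow> 0}"

definition num_range :: "complex set \<Rightarrow> (complex \<Rightarrow> ('a::complex_inner, 'a) oper) \<Rightarrow> complex set" where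
  "num_range \<Omega> T = {z\<in>\<Omega>. \<exists>f\<in>opdom (T z). f \<noteq> 0 \<and> cinner (opapp (T z) f) f = 0}"

definition pseudo_num_range ::
    "complex set \<Rightarrow> (complex \<Rightarrow> ('a::complex_inner, 'a) oper) \<Rightarrow> complex set" where
  "pseudo_num_range \<Omega> T = (\<Inter>\<epsilon>\<in>{0<..}. \<Union>M\<in>{M. bounded_clinear M \<and> onorm M < \<epsilon>}.
     num_range \<Omega> (\<lambda>z. op_plus (T z) M))"

section \<open>Operator matrices\<close>

datatype ('a, 'b) opmat = OpMat
  (ent11: "('a, 'a) oper") (ent12: "('b, 'a) oper")
  (ent21: "('a, 'b) oper") (ent22: "('b, 'b) oper")

definition mat_dom1 :: "('a, 'b) opmat \<Rightarrow> 'a set" where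
  "mat_dom1 L = opdom (ent11 L) \<inter> opdom (ent21 L)"

definition mat_dom2 :: "('a, 'b) opmat \<Rightarrow> 'b set" where
  "mat_dom2 L = opdom (ent12 L) \<inter> opdom (ent22 L)"

definition mat_op :: "('a::complex_inner, 'b::complex_inner) opmat \<Rightarrow> ('a \<times> 'b, 'a \<times> 'b) oper" where
  "mat_op L = Oper (mat_dom1 L \<times> mat_dom2 L)
     (\<lambda>(f, g). (opapp (ent11 L) f + opapp (ent12 L) g, opapp (ent21 L) f + opapp (ent22 L) g))"

text \<open>The sum of an operator matrix and a bounded operator on the direct sum, the latter being
  decomposed into its four blocks.\<close>

definition mat_plus ::
    "('a::complex_inner, 'b::complex_inner) opmat \<Rightarrow> ('a \<times> 'b \<Rightarrow> 'a \<times> 'b) \<Rightarrow> ('a, 'b) opmat" where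
  "mat_plus L M = OpMat
     (op_plus (ent11 L) (\<lambda>f. fst (M (f, 0)))) (op_plus (ent12 L) (\<lambda>g. fst (M (0, g))))
     (op_plus (ent21 L) (\<lambda>f. snd (M (f, 0)))) (op_plus (ent22 L) (\<lambda>g. snd (M (0, g))))"

text \<open>Schur complements, used only where \<^term>\<open>ent22 L\<close>, respectively \<^term>\<open>ent11 L\<close>, is
  boundedly invertible.\<close>

definition schur1 :: "('a::complex_inner, 'b::complex_inner) opmat \<Rightarrow> ('a, 'a) oper" where
  "schur1 L = Oper {f \<in> mat_dom1 L. op_inv (ent22 L) (opapp (ent21 L) f) \<in> opdom (ent12 L)}
     (\<lambda>f. opapp (ent11 L) f - opapp (ent12 L) (op_inv (ent22 L) (opapp (ent21 L) f)))"

definition schur2 :: "('a::complex_inner, 'b::complex_inner) opmat \<Rightarrow> ('b, 'b) oper" where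
  "schur2 L = Oper {g \<in> mat_dom2 L. op_inv (ent11 L) (opapp (ent12 L) g) \<in> opdom (ent21 L)}
     (\<lambda>g. opapp (ent22 L) g - opapp (ent21 L) (op_inv (ent11 L) (opapp (ent12 L) g)))"

definition quad_num_range ::
    "complex set \<Rightarrow> (complex \<Rightarrow> ('a::complex_inner, 'b::complex_inner) opmat) \<Rightarrow> complex set" where
  "quad_num_range \<Omega> L = {z\<in>\<Omega>. \<exists>f\<in>mat_dom1 (L z). \<exists>g\<in>mat_dom2 (L z). norm f = 1 \<and> norm g = 1 \<and>
     det (vector [vector [cinner (opapp (ent11 (L z)) f) f, cinner (opapp (ent12 (L z)) g) f],
                  vector [cinner (opapp (ent21 (L z)) f) g, cinner (opapp (ent22 (L z)) g) g]]
          :: complex^2^2) = 0}"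

definition pseudo_quad_num_range ::
    "complex set \<Rightarrow> (complex \<Rightarrow> ('a::complex_inner, 'b::complex_inner) opmat) \<Rightarrow> complex set" where
  "pseudo_quad_num_range \<Omega> L = (\<Inter>\<epsilon>\<in>{0<..}. \<Union>M\<in>{M. bounded_clinear M \<and> onorm M < \<epsilon>}.
     quad_num_range \<Omega> (\<lambda>z. mat_plus (L z) M))"

definition pseudo_quad_num_range_diag ::
    "complex set \<Rightarrow> (complex \<Rightarrow> ('a::complex_inner, 'b::complex_inner) opmat) \<Rightarrow> complex set" where
  "pseudo_quad_num_range_diag \<Omega> L = (\<Inter>\<epsilon>\<in>{0<..}.
     \<Union>M\<^sub>1\<in>{M. bounded_clinear M \<and> onorm M < \<epsilon>}. \<Union>M\<^sub>2\<in>{M. bounded_clinear M \<and> onorm M < \<epsilon>}.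
     quad_num_range \<Omega> (\<lambda>z. mat_plus (L z) (map_prod M\<^sub>1 M\<^sub>2)))"

end

theory Submission
  imports Defs
begin

text \<open>Let \<open>(f, g)\<close> be a unit vector on which \<open>L\<close> is almost zero, with image \<open>(u, v)\<close>. Since
  \<open>C \<subseteq> \<plusminus>B*\<close>, the off-diagonal terms cancel in the real part of \<open>(u, f) \<minusplus> (v, g)\<close>, so the nonnegative
  numbers \<open>Re (A f, f)\<close> and \<open>\<minusplus>Re (D g, g)\<close> are both small and, by sectoriality, so is \<open>(D g, g)\<close>. If \<open>0\<close>
  is at positive distance from the numerical range of \<open>D\<close>, this makes \<open>g\<close> small, and then
  \<open>S\<^sub>1 f = u - B D\<^sup>-\<^sup>1 v\<close> is small because \<open>B D\<^sup>-\<^sup>1\<close> is bounded. For the quadratic numerical range one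
  perturbs by multiples of the identity: the pair \<open>f\<close>, \<open>- D\<^sup>-\<^sup>1 C f\<close> serves when \<open>S\<^sub>1 f\<close> is small, and
  when \<open>(D g, g)\<close> is small one takes \<open>f\<close> orthogonal to \<open>B g\<close>, which needs dimension at least two.
  Part (ii) is part (i) for the matrix with both components interchanged.\<close>

section \<open>Complex inner products\<close>

lemma cinner_scaleC_right: "cinner x (scaleC c y) = cnj c * cinner x (y::'a::complex_inner)"
  by (metis cinner_commute cinner_scaleC_left complex_cnj_mult)

lemma cinner_add_right: "cinner x (y + z) = cinner x y + cinner x (z::'a::complex_inner)"
  by (metis cinner_commute cinner_add_left complex_cnj_add)

lemma cinner_zero_left [simp]: "cinner 0 (x::'a::complex_inner) = 0"
  using cinner_add_left[of 0 0 x] by simp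

lemma cinner_zero_right [simp]: "cinner (x::'a::complex_inner) 0 = 0"
  using cinner_add_right[of x 0 0] by simp

lemma cinner_minus_left: "cinner (- x) y = - cinner x (y::'a::complex_inner)"
  using cinner_add_left[of x "- x" y] by (simp add: eq_neg_iff_add_eq_0 add.commute)

lemma cinner_diff_left: "cinner (x - y) z = cinner x z - cinner y (z::'a::complex_inner)"
  using cinner_add_left[of x "- y" z] by (simp add: cinner_minus_left)

lemma cinner_self: "cinner x x = complex_of_real ((norm (x::'a::complex_inner))\<^sup>2)"
proof (rule complex_eqI)
  show "Re (cinner x x) = Re (complex_of_real ((norm x)\<^sup>2))"
    by (simp add: inner_eq_Re_cinner[symmetric] power2_norm_eq_inner)
  have "Im (cinner x x) = - Im (cinner x x)"
    by (metis cinner_commute cnj.simps(2))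
  then show "Im (cinner x x) = Im (complex_of_real ((norm x)\<^sup>2))" by simp
qed

text \<open>The norm is that of the real inner product, so complex homogeneity has to be derived: (c
  x, c x) = c * cnj c * (x, x).\<close>

lemma norm_scaleC [simp]: "norm (scaleC c x) = cmod c * norm (x::'a::complex_inner)"
proof -
  have "complex_of_real ((norm (scaleC c x))\<^sup>2) = c * cnj c * cinner x x"
    by (simp only: cinner_self[symmetric] cinner_scaleC_left cinner_scaleC_right mult_ac)
  also have "\<dots> = complex_of_real ((cmod c * norm x)\<^sup>2)"
    by (simp only: cinner_self complex_norm_square[symmetric] power_mult_distrib of_real_mult)
  finally have "(norm (scaleC c x))\<^sup>2 = (cmod c * norm x)\<^sup>2"
    by (simp only: of_real_eq_iff)
  then show ?thesis by (simp add: power2_eq_iff_nonneg)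
qed

text \<open>Multiplying \<open>x\<close> by a suitable scalar \<open>u\<close> turns
  \<open>cinner x y\<close> into its modulus, and the real Cauchy-Schwarz inequality applies to the
  rotated vector.\<close>

lemma cmod_cinner_le: "cmod (cinner x y) \<le> norm x * norm (y::'a::complex_inner)"
proof -
  define u where "u = cnj (sgn (cinner x y))"
  have "u * cinner x y = complex_of_real (cmod (cinner x y))"
  proof (cases "cinner x y = 0")
    case False
    have "u * cinner x y = cinner x y * cnj (cinner x y) / complex_of_real (cmod (cinner x y))"
      by (simp add: u_def sgn_eq)
    then show ?thesis
      using False by (simp add: complex_norm_square[symmetric] power2_eq_square)
  qed simp
  then have "cmod (cinner x y) = inner (scaleC u x) y"
    by (simp add: inner_eq_Re_cinner cinner_scaleC_left)
  also have "\<dots> \<le> norm (scaleC u x) * norm y" by (rule norm_cauchy_schwarz)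
  \<comment> \<open>Only \<open>cmod u \<le> 1\<close> is available, because
    \<open>sgn 0 = 0\<close>.\<close>
  also have "\<dots> \<le> 1 * norm x * norm y"
    unfolding norm_scaleC by (intro mult_right_mono) (auto simp: u_def norm_sgn)
  finally show ?thesis by simp
qed

lemma bounded_linear_cinner_left: "bounded_linear (\<lambda>x. cinner x (y::'a::complex_inner))"
proof (rule bounded_linear_intro)
  show "cmod (cinner x y) \<le> norm x * norm y" for x by (rule cmod_cinner_le)
qed (auto simp: cinner_add_left scaleR_eq_scaleC cinner_scaleC_left scaleR_conv_of_real)

lemma bounded_linear_scaleC: "bounded_linear (scaleC c :: 'a \<Rightarrow> 'a::complex_inner)"
proof (rule bounded_linear_intro)
  show "norm (scaleC c x) \<le> norm x * cmod c" for x :: 'a by (simp add: mult.commute)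
qed (auto simp: scaleC_add_right scaleR_eq_scaleC scaleC_scaleC mult.commute)

lemma bounded_clinear_scaleC: "bounded_clinear (scaleC c :: 'a \<Rightarrow> 'a::complex_inner)"
  by (auto simp: bounded_clinear_def bounded_linear_scaleC scaleC_scaleC mult.commute)

lemma onorm_scaleC_le: "onorm (scaleC c :: 'a \<Rightarrow> 'a::complex_inner) \<le> cmod c"
  by (rule onorm_bound) auto

lemma bounded_linear_scaleC_left: "bounded_linear (\<lambda>c. scaleC c (x::'a::complex_inner))"
  by (rule bounded_linear_intro[where K = "norm x"])
    (auto simp: scaleC_add_left scaleR_eq_scaleC scaleC_scaleC scaleR_conv_of_real)

section \<open>Linear operators and approximate null vectors\<close>

lemma op_linearD:
  assumes "op_linear T"
  shows op_linear_subspace: "cvec.subspace (opdom T)"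
    and op_linear_add: "x \<in> opdom T \<Longrightarrow> y \<in> opdom T \<Longrightarrow> opapp T (x + y) = opapp T x + opapp T y"
    and op_linear_scaleC: "x \<in> opdom T \<Longrightarrow> opapp T (scaleC c x) = scaleC c (opapp T x)"
  using assms by (auto simp: op_linear_def)

lemma op_linear_scaleC_mem: "op_linear T \<Longrightarrow> x \<in> opdom T \<Longrightarrow> scaleC c x \<in> opdom T"
  by (simp add: cvec.subspace_scale op_linear_subspace)

text \<open>Membership in the approximate point spectrum for a single operator and without
  sequences, a form suited to estimates with \<epsilon>.\<close>

definition approx_null :: "('a::complex_inner, 'b::complex_inner) oper \<Rightarrow> bool" where
  "approx_null T \<longleftrightarrow> (\<forall>\<epsilon>>0. \<exists>f\<in>opdom T. norm f = 1 \<and> norm (opapp T f) < \<epsilon>)"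

text \<open>This says that 0 lies in the closure of the numerical range formed with unit vectors;
  its negation provides a positive distance.\<close>

definition form_null :: "('a::complex_inner, 'a) oper \<Rightarrow> bool" where
  "form_null T \<longleftrightarrow> (\<forall>\<epsilon>>0. \<exists>f\<in>opdom T. norm f = 1 \<and> cmod (cinner (opapp T f) f) < \<epsilon>)"

lemma approx_null_imp_form_null:
  assumes "approx_null T"
  shows "form_null T"
  unfolding form_null_def
proof (intro allI impI)
  fix \<epsilon> :: real assume "\<epsilon> > 0"
  then obtain f where f: "f \<in> opdom T" "norm f = 1" "norm (opapp T f) < \<epsilon>"
    using assms by (auto simp: approx_null_def)
  have "cmod (cinner (opapp T f) f) < \<epsilon>"
    using cmod_cinner_le[of "opapp T f" f] f by simp
  with f show "\<exists>f\<in>opdom T. norm f = 1 \<and> cmod (cinner (opapp T f) f) < \<epsilon>" by blast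
qed

lemma fam_ap_spectrum_iff: "z \<in> fam_ap_spectrum \<Omega> T \<longleftrightarrow> z \<in> \<Omega> \<and> approx_null (T z)"
proof (intro iffI conjI)
  assume "z \<in> fam_ap_spectrum \<Omega> T"
  then obtain f where f: "z \<in> \<Omega>" "\<And>n. f n \<in> opdom (T z)" "\<And>n. norm (f n) = 1"
      "(\<lambda>n. opapp (T z) (f n)) \<longlonglongrightarrow> 0"
    by (auto simp: fam_ap_spectrum_def)
  show "z \<in> \<Omega>" by fact
  show "approx_null (T z)"
    unfolding approx_null_def
  proof (intro allI impI)
    fix \<epsilon> :: real assume "\<epsilon> > 0"
    with f(4) obtain n where "norm (opapp (T z) (f n)) < \<epsilon>"
      by (metis LIMSEQ_iff diff_zero order_refl)
    with f show "\<exists>f\<in>opdom (T z). norm f = 1 \<and> norm (opapp (T z) f) < \<epsilon>" by blast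
  qed
next
  assume *: "z \<in> \<Omega> \<and> approx_null (T z)"
  have "\<forall>n. \<exists>f\<in>opdom (T z). norm f = 1 \<and> norm (opapp (T z) f) < inverse (real (Suc n))"
    using * unfolding approx_null_def by simp
  then obtain f where f: "\<And>n. f n \<in> opdom (T z)" "\<And>n. norm (f n) = 1"
      "\<And>n. norm (opapp (T z) (f n)) < inverse (real (Suc n))"
    by metis
  have "(\<lambda>n. opapp (T z) (f n)) \<longlonglongrightarrow> 0"
    by (rule Lim_null_comparison[OF _ LIMSEQ_inverse_real_of_nat])
      (use f(3) in \<open>simp add: less_imp_le del: of_nat_Suc\<close>)
  with f * show "z \<in> fam_ap_spectrum \<Omega> T"
    by (auto simp: fam_ap_spectrum_def)
qed

text \<open>Subtracting the small number \<open>\<mu>\<close> = (T f, f) times the identity makes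
  the quadratic form vanish at the unit vector \<open>f\<close>; this perturbation has norm at most
  \<open>cmod \<mu>\<close>.\<close>

lemma form_null_imp_pseudo_num_range:
  assumes "z \<in> \<Omega>" "form_null (T z)"
  shows "z \<in> pseudo_num_range \<Omega> T"
  unfolding pseudo_num_range_def
proof (rule INT_I)
  fix \<epsilon> :: real assume "\<epsilon> \<in> {0<..}"
  then obtain f where f: "f \<in> opdom (T z)" "norm f = 1" "cmod (cinner (opapp (T z) f) f) < \<epsilon>"
    using assms(2) by (auto simp: form_null_def)
  define \<mu> where "\<mu> = cinner (opapp (T z) f) f"
  have "onorm (scaleC (- \<mu>) :: 'a \<Rightarrow> 'a) < \<epsilon>"
    using onorm_scaleC_le[of "- \<mu>", where 'a = 'a] f(3) by (simp add: \<mu>_def)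
  moreover have "z \<in> num_range \<Omega> (\<lambda>z. op_plus (T z) (scaleC (- \<mu>)))"
    using f assms(1)
    by (auto simp: num_range_def op_plus_def cinner_add_left cinner_scaleC_left cinner_self \<mu>_def
        cinner_diff_left intro!: bexI[of _ f])
  ultimately show "z \<in> (\<Union>M\<in>{M. bounded_clinear M \<and> onorm M < \<epsilon>}. num_range \<Omega> (\<lambda>z. op_plus (T z) M))"
    using bounded_clinear_scaleC by blast
qed

lemma ap_spectrum_subset_pseudo_num_range: "fam_ap_spectrum \<Omega> T \<subseteq> pseudo_num_range \<Omega> T"
proof
  fix z assume "z \<in> fam_ap_spectrum \<Omega> T"
  then show "z \<in> pseudo_num_range \<Omega> T"
    unfolding fam_ap_spectrum_iff
    by (intro form_null_imp_pseudo_num_range approx_null_imp_form_null) auto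
qed

section \<open>Bounded inverses, adjoints and sectorial forms\<close>

lemma fam_resolventD:
  assumes "z \<in> fam_resolvent \<Omega> T"
  shows "z \<in> \<Omega>" "bij_betw (opapp (T z)) (opdom (T z)) UNIV" "bounded_clinear (op_inv (T z))"
proof -
  have "op_plus (T z) (\<lambda>x. - scaleC 0 x) = T z"
    by (cases "T z") (simp add: op_plus_def)
  then show "z \<in> \<Omega>" "bij_betw (opapp (T z)) (opdom (T z)) UNIV" "bounded_clinear (op_inv (T z))"
    using assms by (auto simp: fam_resolvent_def fam_spectrum_def op_spectrum_def
        op_resolvent_set_def Let_def)
qed

lemma op_inv_right:
  assumes "bij_betw (opapp T) (opdom T) UNIV"
  shows "op_inv T y \<in> opdom T" "opapp T (op_inv T y) = y"
proof -
  have *: "inj_on (opapp T) (opdom T)" "y \<in> opapp T ` opdom T"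
    using assms by (auto simp: bij_betw_def)
  show "op_inv T y \<in> opdom T"
    unfolding op_inv_def using the_inv_into_into[OF * order_refl] .
  show "opapp T (op_inv T y) = y"
    unfolding op_inv_def using f_the_inv_into_f[OF *] .
qed

lemma op_inv_left:
  assumes "bij_betw (opapp T) (opdom T) UNIV" "x \<in> opdom T"
  shows "op_inv T (opapp T x) = x"
  unfolding op_inv_def using assms by (auto simp: bij_betw_def intro: the_inv_into_f_f)

text \<open>The value of the adjoint is a definite description, so it can be computed only once
  \<open>h\<close> is known to be unique; this is where the density of \<open>opdom B\<close>
  enters.\<close>

lemma op_subset_scale_adj:
  assumes "densely_defined B" "op_subset C (op_scale s (op_adj B))" "f \<in> opdom C" "g \<in> opdom B"
  shows "cinner (opapp C f) g = s * cnj (cinner (opapp B g) f)"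
proof -
  obtain h where h: "\<forall>g\<in>opdom B. cinner (opapp B g) f = cinner g h"
    using assms(2,3) that by (force simp: op_subset_def op_scale_def op_adj_def)
  have "h' = h" if h': "\<forall>g\<in>opdom B. cinner (opapp B g) f = cinner g h'" for h'
  proof -
    \<comment> \<open>The functionals given by \<open>h\<close> and \<open>h'\<close> agree on a
      closed set that contains the dense domain, hence everywhere.\<close>
    have "closed {x. cinner x h = cinner x h'}"
      by (intro closed_Collect_eq linear_continuous_on bounded_linear_cinner_left)
    moreover have "opdom B \<subseteq> {x. cinner x h = cinner x h'}" using h h' by auto
    ultimately have "\<And>x. cinner x h = cinner x h'"
      using assms(1) closure_minimal unfolding densely_defined_def by blast
    then have "\<And>x. inner x h = inner x h'" by (simp add: inner_eq_Re_cinner)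
    then show "h' = h" by (metis vector_eq_ldot)
  qed
  with h have "(THE h. \<forall>g\<in>opdom B. cinner (opapp B g) f = cinner g h) = h"
    by (intro the_equality) auto
  moreover have "opapp C f = opapp (op_scale s (op_adj B)) f"
    using assms(2,3) by (simp add: op_subset_def)
  ultimately have "opapp C f = scaleC s h"
    by (simp add: op_scale_def op_adj_def)
  then show ?thesis
    using h assms(4) by (metis cinner_commute cinner_scaleC_left)
qed

text \<open>The real part of a number is its modulus times the cosine of its argument, and in the
  sector this cosine is at least \<open>cos \<omega> > 0\<close>. So K = 1 / cos \<omega>
  works.\<close>

lemma sectorial0_bound:
  assumes "sectorial0 T"
  obtains K where "K > 0"
    "\<And>f. f \<in> opdom T \<Longrightarrow> cmod (cinner (opapp T f) f) \<le> K * Re (cinner (opapp T f) f)"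
proof -
  obtain \<omega> where \<omega>: "0 \<le> \<omega>" "\<omega> < pi / 2"
      "\<And>f. f \<in> opdom T \<Longrightarrow> \<bar>Arg (cinner (opapp T f) f)\<bar> \<le> \<omega>"
    using assms by (auto simp: sectorial0_def)
  have pos: "cos \<omega> > 0" using \<omega> by (intro cos_gt_zero_pi) auto
  have "cmod w \<le> inverse (cos \<omega>) * Re w" if "\<bar>Arg w\<bar> \<le> \<omega>" for w
  proof -
    have "cos \<omega> \<le> cos \<bar>Arg w\<bar>"
      using that \<omega> by (intro cos_monotone_0_pi_le) auto
    then have "cmod w * cos \<omega> \<le> cmod w * cos (Arg w)"
      by (intro mult_left_mono) auto
    also have "\<dots> = Re w" by (metis Re_rcis rcis_cmod_Arg)
    finally show ?thesis using pos by (simp add: field_simps)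
  qed
  with \<omega>(3) pos that[of "inverse (cos \<omega>)"] show ?thesis by simp
qed

section \<open>The approximate point spectrum of an operator matrix\<close>

text \<open>Because \<open>s * s = 1\<close>, the off-diagonal entries contribute \<open>p\<close>
  times (B g, f) and \<open>p\<close> times its conjugate with opposite signs; as \<open>p\<close>
  is real, they cancel in the real part. The first diagonal term is nonnegative and may be
  dropped.\<close>

lemma mat_form_bound:
  fixes p s :: complex
  assumes "s = 1 \<or> s = -1" "p = 1 \<or> p = -1"
    and adj: "cinner (opapp (ent21 L) f) g = s * cnj (cinner (opapp (ent12 L) g) f)"
    and acc: "0 \<le> Re (p * cinner (opapp (ent11 L) f) f)"
    and norm: "norm f \<le> 1" "norm g \<le> 1"
  shows "Re (- s * p * cinner (opapp (ent22 L) g) g) \<le> 2 * norm (opapp (mat_op L) (f, g))"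
proof -
  define u v where "u = opapp (ent11 L) f + opapp (ent12 L) g"
    and "v = opapp (ent21 L) f + opapp (ent22 L) g"
  have uv: "opapp (mat_op L) (f, g) = (u, v)" by (simp add: mat_op_def u_def v_def)
  have "cinner u f = cinner (opapp (ent11 L) f) f + cinner (opapp (ent12 L) g) f"
    "cinner v g = s * cnj (cinner (opapp (ent12 L) g) f) + cinner (opapp (ent22 L) g) g"
    by (simp_all add: u_def v_def cinner_add_left adj)
  then have "Re (p * cinner (opapp (ent11 L) f) f) + Re (- s * p * cinner (opapp (ent22 L) g) g)
      = Re (p * cinner u f) - Re (s * p * cinner v g)"
    using assms(1,2) by auto
  also have "\<dots> \<le> cmod (cinner u f) + cmod (cinner v g)"
    using assms(1,2) abs_Re_le_cmod[of "cinner u f"] abs_Re_le_cmod[of "cinner v g"] by auto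
  also have "\<dots> \<le> norm u + norm v"
    using order_trans[OF cmod_cinner_le mult_left_le[OF norm(1) norm_ge_zero]]
      order_trans[OF cmod_cinner_le mult_left_le[OF norm(2) norm_ge_zero]]
    by (rule add_mono)
  also have "\<dots> \<le> 2 * norm (u, v)"
    using norm_fst_le[of u v] norm_snd_le[of v u] by simp
  finally show ?thesis using acc uv by simp
qed

text \<open>From v = C f + D g follows D^-1 v = D^-1 C f + g, so subtracting B D^-1 v from u = A f +
  B g removes \<open>g\<close>. The inclusion of dom D in dom B yields the additional condition in
  the domain of the Schur complement.\<close>

lemma schur1_apply:
  assumes lin: "op_linear (ent12 L)" "op_linear (ent22 L)"
    and bij: "bij_betw (opapp (ent22 L)) (opdom (ent22 L)) UNIV"
    and inv: "bounded_clinear (op_inv (ent22 L))"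
    and dom: "opdom (ent22 L) \<subseteq> opdom (ent12 L)"
    and fg: "(f, g) \<in> opdom (mat_op L)"
  defines "u \<equiv> opapp (ent11 L) f + opapp (ent12 L) g"
    and "v \<equiv> opapp (ent21 L) f + opapp (ent22 L) g"
  shows "f \<in> opdom (schur1 L)"
    and "opapp (schur1 L) f = u - opapp (ent12 L) (op_inv (ent22 L) v)"
proof -
  have mem: "f \<in> mat_dom1 L" "g \<in> opdom (ent22 L)" "g \<in> opdom (ent12 L)"
    using fg by (auto simp: mat_op_def mat_dom2_def)
  show "f \<in> opdom (schur1 L)"
    using mem op_inv_right(1)[OF bij] dom by (auto simp: schur1_def)
  let ?h = "op_inv (ent22 L) (opapp (ent21 L) f)"
  have "op_inv (ent22 L) v = ?h + g"
    using inv op_inv_left[OF bij mem(2)]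
    by (simp add: v_def bounded_clinear_def linear_add bounded_linear.linear)
  then have "opapp (ent12 L) (op_inv (ent22 L) v) = opapp (ent12 L) ?h + opapp (ent12 L) g"
    using op_linear_add[OF lin(1)] op_inv_right(1)[OF bij] dom mem(3) by auto
  then show "opapp (schur1 L) f = u - opapp (ent12 L) (op_inv (ent22 L) v)"
    by (simp add: schur1_def u_def)
qed

lemma mat_op_scaleC:
  assumes "op_linear (ent11 L)" "op_linear (ent12 L)" "op_linear (ent21 L)" "op_linear (ent22 L)"
    and "x \<in> opdom (mat_op L)"
  shows "scaleC c x \<in> opdom (mat_op L)" "opapp (mat_op L) (scaleC c x) = scaleC c (opapp (mat_op L) x)"
  using assms
  by (auto simp: mat_op_def mat_dom1_def mat_dom2_def scaleC_prod_def op_linear_scaleC_mem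
      op_linear_scaleC scaleC_add_right)

text \<open>If 0 has distance at least \<delta> > 0 from the numerical range of D, then \<delta>
  |g|^2 \<le> |(D g, g)| \<le> 2 K |L (f, g)| for pairs of norm 1. So approximate null vectors of
  the matrix have first components bounded away from 0, and these, once normalised, are approximate
  null vectors of the Schur complement.\<close>

lemma approx_null_mat_op:
  fixes L :: "('a::complex_inner, 'b::complex_inner) opmat" and p s :: complex
  assumes sign: "s = 1 \<or> s = -1" "p = 1 \<or> p = -1"
    and lin: "op_linear (ent11 L)" "op_linear (ent12 L)" "op_linear (ent21 L)" "op_linear (ent22 L)"
    and adj: "\<And>f g. f \<in> opdom (ent21 L) \<Longrightarrow> g \<in> opdom (ent12 L) \<Longrightarrow>
        cinner (opapp (ent21 L) f) g = s * cnj (cinner (opapp (ent12 L) g) f)"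
    and acc: "accretive (op_scale p (ent11 L))"
    and sec: "sectorial0 (op_scale (- s * p) (ent22 L))"
    and rel: "rel_bounded (ent12 L) (ent22 L)"
    and bij: "bij_betw (opapp (ent22 L)) (opdom (ent22 L)) UNIV"
    and inv: "bounded_clinear (op_inv (ent22 L))"
    and null: "approx_null (mat_op L)"
  shows "approx_null (schur1 L) \<or> form_null (ent22 L)"
proof (rule disjCI)
  assume "\<not> form_null (ent22 L)"
  then obtain \<delta> where \<delta>: "\<delta> > 0"
      "\<And>g. g \<in> opdom (ent22 L) \<Longrightarrow> norm g = 1 \<Longrightarrow> \<delta> \<le> cmod (cinner (opapp (ent22 L) g) g)"
    unfolding form_null_def by (metis not_le)
  \<comment> \<open>By homogeneity the bound passes from unit vectors to all of dom D; the second
    component of a unit pair need not be a unit vector.\<close>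
  have lower: "\<delta> * (norm g)\<^sup>2 \<le> cmod (cinner (opapp (ent22 L) g) g)" if g: "g \<in> opdom (ent22 L)" for g
  proof (cases "g = 0")
    case False
    define c where "c = complex_of_real (inverse (norm g))"
    have "\<delta> \<le> cmod (cinner (opapp (ent22 L) (scaleC c g)) (scaleC c g))"
      using False by (intro \<delta>(2) op_linear_scaleC_mem lin g) (simp add: c_def norm_inverse)
    also have "\<dots> = cmod (cinner (opapp (ent22 L) g) g) / (norm g)\<^sup>2"
      by (simp add: op_linear_scaleC[OF lin(4) g] cinner_scaleC_left cinner_scaleC_right c_def
          norm_mult norm_inverse divide_inverse power2_eq_square)
    finally show ?thesis using False by (simp add: field_simps)
  qed simp
  obtain K where K: "K > 0" "\<And>g. g \<in> opdom (ent22 L) \<Longrightarrow>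
      cmod (cinner (opapp (ent22 L) g) g) \<le> K * Re (- s * p * cinner (opapp (ent22 L) g) g)"
  proof (rule sectorial0_bound[OF sec])
    fix K assume "K > 0" and *: "\<And>f. f \<in> opdom (op_scale (- s * p) (ent22 L)) \<Longrightarrow>
      cmod (cinner (opapp (op_scale (- s * p) (ent22 L)) f) f)
        \<le> K * Re (cinner (opapp (op_scale (- s * p) (ent22 L)) f) f)"
    \<comment> \<open>The sign factor drops out of the modulus on the left but stays inside the real
      part on the right.\<close>
    have "cmod s = 1" "cmod p = 1" using sign by auto
    with * have "\<And>g. g \<in> opdom (ent22 L) \<Longrightarrow>
      cmod (cinner (opapp (ent22 L) g) g) \<le> K * Re (- s * p * cinner (opapp (ent22 L) g) g)"
      by (simp add: op_scale_def cinner_scaleC_left norm_mult del: cvec.scale_minus_left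
          times_complex.sel)
    with \<open>K > 0\<close> show ?thesis by (rule that)
  qed
  obtain a b where ab: "a \<ge> 0" "b \<ge> 0" "\<And>x. x \<in> opdom (ent22 L) \<Longrightarrow>
      norm (opapp (ent12 L) x) \<le> a * norm x + b * norm (opapp (ent22 L) x)"
    and dom: "opdom (ent22 L) \<subseteq> opdom (ent12 L)"
    using rel by (auto simp: rel_bounded_def)
  obtain R where R: "R > 0" "\<And>y. norm (op_inv (ent22 L) y) \<le> norm y * R"
    using inv unfolding bounded_clinear_def by (metis bounded_linear.pos_bounded)
  \<comment> \<open>A bound for B D^-1: in the relative bound at x = D^-1 y, the norm of x is at
    most \<open>R\<close> times that of y, and D x is y.\<close>
  define M where "M = a * R + b"
  have M: "norm (opapp (ent12 L) (op_inv (ent22 L) y)) \<le> M * norm y" for y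
  proof -
    have "norm (opapp (ent12 L) (op_inv (ent22 L) y)) \<le> a * norm (op_inv (ent22 L) y) + b * norm y"
      using ab(3)[OF op_inv_right(1)[OF bij]] op_inv_right(2)[OF bij] by metis
    also have "\<dots> \<le> a * (norm y * R) + b * norm y"
      using R(2) ab(1) by (intro add_right_mono mult_left_mono) auto
    finally show ?thesis by (simp add: M_def algebra_simps)
  qed
  have M0: "M \<ge> 0" using ab R by (simp add: M_def)
  show "approx_null (schur1 L)"
    unfolding approx_null_def
  proof (intro allI impI)
    fix \<epsilon> :: real assume "\<epsilon> > 0"
    \<comment> \<open>The first entry forces |g|^2 \<le> 3/4 and hence |f| \<ge> 1/2; the second
      brings the final bound 2 \<eta> (1 + M) down to \<epsilon>.\<close>
    define \<eta> where "\<eta> = min (3 * \<delta> / (8 * K)) (\<epsilon> / (2 * (1 + M)))"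
    have "\<eta> > 0" using \<open>\<epsilon> > 0\<close> \<delta>(1) K(1) M0 by (simp add: \<eta>_def)
    then obtain f g where fg: "(f, g) \<in> opdom (mat_op L)" "norm (f, g) = 1"
        "norm (opapp (mat_op L) (f, g)) < \<eta>"
      using null unfolding approx_null_def by force
    have mem: "f \<in> opdom (ent11 L)" "f \<in> opdom (ent21 L)" "g \<in> opdom (ent22 L)" "g \<in> opdom (ent12 L)"
      using fg(1) by (auto simp: mat_op_def mat_dom1_def mat_dom2_def)
    have le1: "norm f \<le> 1" "norm g \<le> 1"
      using norm_fst_le[of f g] norm_snd_le[of g f] fg(2) by auto
    have "\<delta> * (norm g)\<^sup>2 \<le> K * Re (- s * p * cinner (opapp (ent22 L) g) g)"
      using lower[OF mem(3)] K(2)[OF mem(3)] by linarith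
    also have "\<dots> \<le> K * (2 * norm (opapp (mat_op L) (f, g)))"
      using acc mem K(1)
      by (intro mult_left_mono mat_form_bound sign adj le1)
        (auto simp: accretive_def op_scale_def cinner_scaleC_left)
    also have "\<dots> \<le> K * (2 * (3 * \<delta> / (8 * K)))"
      using fg(3) K(1) by (intro mult_left_mono) (auto simp: \<eta>_def)
    also have "\<dots> = \<delta> * (3 / 4)" using K(1) by simp
    finally have "(norm g)\<^sup>2 \<le> 3 / 4" using \<delta>(1) by simp
    moreover have "(norm f)\<^sup>2 + (norm g)\<^sup>2 = 1"
      using fg(2) by (simp add: norm_Pair real_sqrt_eq_1_iff)
    ultimately have "(1 / 2)\<^sup>2 \<le> (norm f)\<^sup>2" by (simp add: power2_eq_square)
    then have f2: "norm f \<ge> 1 / 2" by (rule power2_le_imp_le) simp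
    \<comment> \<open>The pair is rescaled so that its first component, not the whole pair, becomes
      a unit vector. The factor is at most 2, so the residual at most doubles.\<close>
    define c where "c = complex_of_real (inverse (norm f))"
    define w where "w = opapp (mat_op L) (scaleC c f, scaleC c g)"
    have fg': "(scaleC c f, scaleC c g) \<in> opdom (mat_op L)"
      and w: "w = scaleC c (opapp (mat_op L) (f, g))"
      using mat_op_scaleC[OF lin fg(1), of c] by (simp_all add: w_def scaleC_prod_def)
    have "cmod c \<le> 2" using f2 by (simp add: c_def norm_divide inverse_eq_divide divide_le_eq)
    then have nw: "norm w < 2 * \<eta>"
      unfolding w norm_scaleC
      using fg(3) mult_right_mono[OF _ norm_ge_zero, of "cmod c" 2 "opapp (mat_op L) (f, g)"] by simp
    note S = schur1_apply[OF lin(2,4) bij inv dom fg']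
    have "opapp (schur1 L) (scaleC c f) = fst w - opapp (ent12 L) (op_inv (ent22 L) (snd w))"
      unfolding S(2) by (simp add: w_def mat_op_def)
    then have "norm (opapp (schur1 L) (scaleC c f)) \<le> norm (fst w) + M * norm (snd w)"
      using norm_triangle_ineq4[of "fst w"] M[of "snd w"] by (metis add_left_mono order_trans)
    also have "\<dots> \<le> norm w + M * norm w"
      using norm_fst_le[of "fst w" "snd w"] norm_snd_le[of "snd w" "fst w"] M0
      by (intro add_mono mult_left_mono) auto
    also have "\<dots> = norm w * (1 + M)" by (simp add: algebra_simps)
    also have "\<dots> < 2 * \<eta> * (1 + M)"
      using nw M0 by (intro mult_strict_right_mono) auto
    also have "\<dots> \<le> 2 * (\<epsilon> / (2 * (1 + M))) * (1 + M)"
      using M0 by (intro mult_right_mono mult_left_mono) (auto simp: \<eta>_def)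
    also have "\<dots> = \<epsilon>" using M0 by (simp add: field_simps)
    finally have "norm (opapp (schur1 L) (scaleC c f)) < \<epsilon>" .
    moreover have "norm (scaleC c f) = 1"
      using f2 by (cases "f = 0") (simp_all add: c_def norm_inverse)
    ultimately show "\<exists>f\<in>opdom (schur1 L). norm f = 1 \<and> norm (opapp (schur1 L) f) < \<epsilon>"
      using S(1) by blast
  qed
qed

section \<open>The pseudo quadratic numerical range\<close>

text \<open>Multiples of the identity, used as diagonal perturbations, change only the diagonal
  entries. Both products in the determinant scale alike in \<open>f\<close> and in \<open>g\<close>,
  so the vanishing may be checked on nonzero vectors that are not normalised.\<close>

lemma pseudo_quad_num_range_diagI:
  assumes z: "z \<in> \<Omega>"
    and lin: "op_linear (ent11 (L z))" "op_linear (ent12 (L z))" "op_linear (ent21 (L z))"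
      "op_linear (ent22 (L z))"
    and ex: "\<And>\<epsilon>. \<epsilon> > 0 \<Longrightarrow> \<exists>\<mu> \<nu>. \<exists>f\<in>mat_dom1 (L z). \<exists>g\<in>mat_dom2 (L z).
      cmod \<mu> < \<epsilon> \<and> cmod \<nu> < \<epsilon> \<and> f \<noteq> 0 \<and> g \<noteq> 0 \<and>
      (cinner (opapp (ent11 (L z)) f) f + \<mu> * cinner f f) *
      (cinner (opapp (ent22 (L z)) g) g + \<nu> * cinner g g) =
      cinner (opapp (ent12 (L z)) g) f * cinner (opapp (ent21 (L z)) f) g"
  shows "z \<in> pseudo_quad_num_range_diag \<Omega> (L :: complex \<Rightarrow> ('a::complex_inner, 'b::complex_inner) opmat)"
  unfolding pseudo_quad_num_range_diag_def
proof (rule INT_I)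
  fix \<epsilon> :: real assume "\<epsilon> \<in> {0<..}"
  then obtain \<mu> \<nu> f g where fg: "f \<in> mat_dom1 (L z)" "g \<in> mat_dom2 (L z)"
      "cmod \<mu> < \<epsilon>" "cmod \<nu> < \<epsilon>" "f \<noteq> 0" "g \<noteq> 0"
    and eq: "(cinner (opapp (ent11 (L z)) f) f + \<mu> * cinner f f) *
      (cinner (opapp (ent22 (L z)) g) g + \<nu> * cinner g g) =
      cinner (opapp (ent12 (L z)) g) f * cinner (opapp (ent21 (L z)) f) g"
    using ex[of \<epsilon>] by auto
  let ?M = "scaleC \<mu> :: 'a \<Rightarrow> 'a" and ?N = "scaleC \<nu> :: 'b \<Rightarrow> 'b"
  have small: "onorm ?M < \<epsilon>" "onorm ?N < \<epsilon>"
    using onorm_scaleC_le[of \<mu>, where 'a = 'a] onorm_scaleC_le[of \<nu>, where 'a = 'b] fg by auto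
  define a b where "a = complex_of_real (inverse (norm f))" and "b = complex_of_real (inverse (norm g))"
  have cnj: "cnj a = a" "cnj b = b" by (simp_all add: a_def b_def)
  have mem: "scaleC a f \<in> mat_dom1 (L z)" "scaleC b g \<in> mat_dom2 (L z)"
    using fg lin by (auto simp: mat_dom1_def mat_dom2_def op_linear_scaleC_mem)
  have unit: "norm (scaleC a f) = 1" "norm (scaleC b g) = 1"
    using fg by (simp_all add: a_def b_def norm_inverse)
  have dom: "f \<in> opdom (ent11 (L z))" "f \<in> opdom (ent21 (L z))"
    "g \<in> opdom (ent12 (L z))" "g \<in> opdom (ent22 (L z))"
    using fg by (auto simp: mat_dom1_def mat_dom2_def)
  let ?P = "mat_plus (L z) (map_prod ?M ?N)"
  note simps = mat_plus_def op_plus_def cinner_add_left cinner_scaleC_left cinner_scaleC_right cnj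
    scaleC_scaleC distrib_left mult_ac
  have e11: "cinner (opapp (ent11 ?P) (scaleC a f)) (scaleC a f) =
      a * a * (cinner (opapp (ent11 (L z)) f) f + \<mu> * cinner f f)"
    by (simp add: simps op_linear_scaleC[OF lin(1) dom(1)])
  have e12: "cinner (opapp (ent12 ?P) (scaleC b g)) (scaleC a f) =
      a * b * cinner (opapp (ent12 (L z)) g) f"
    by (simp add: simps op_linear_scaleC[OF lin(2) dom(3)])
  have e21: "cinner (opapp (ent21 ?P) (scaleC a f)) (scaleC b g) =
      a * b * cinner (opapp (ent21 (L z)) f) g"
    by (simp add: simps op_linear_scaleC[OF lin(3) dom(2)])
  have e22: "cinner (opapp (ent22 ?P) (scaleC b g)) (scaleC b g) =
      b * b * (cinner (opapp (ent22 (L z)) g) g + \<nu> * cinner g g)"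
    by (simp add: simps op_linear_scaleC[OF lin(4) dom(4)])
  \<comment> \<open>Normalising multiplies both sides of \<open>eq\<close> by the same factor
    \<open>a * a * b * b\<close>, since \<open>a\<close> and \<open>b\<close> are real.\<close>
  have eq': "(a * a * (cinner (opapp (ent11 (L z)) f) f + \<mu> * cinner f f)) *
      (b * b * (cinner (opapp (ent22 (L z)) g) g + \<nu> * cinner g g)) =
      (a * b * cinner (opapp (ent12 (L z)) g) f) * (a * b * cinner (opapp (ent21 (L z)) f) g)"
    using arg_cong[OF eq, of "\<lambda>x. a * a * b * b * x"] by (simp only: mult_ac)
  have mem': "scaleC a f \<in> mat_dom1 ?P" "scaleC b g \<in> mat_dom2 ?P"
    using mem by (simp_all add: mat_plus_def op_plus_def mat_dom1_def mat_dom2_def)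
  have det: "det (vector [
      vector [cinner (opapp (ent11 ?P) (scaleC a f)) (scaleC a f),
        cinner (opapp (ent12 ?P) (scaleC b g)) (scaleC a f)],
      vector [cinner (opapp (ent21 ?P) (scaleC a f)) (scaleC b g),
        cinner (opapp (ent22 ?P) (scaleC b g)) (scaleC b g)]]
      :: complex^2^2) = 0"
    unfolding det_2 vector_2 e11 e12 e21 e22 eq' by (rule right_minus_eq[THEN iffD2, OF refl])
  have "z \<in> quad_num_range \<Omega> (\<lambda>z. mat_plus (L z) (map_prod ?M ?N))"
    unfolding quad_num_range_def
    by (rule CollectI, rule conjI[OF z], rule bexI[where x = "scaleC a f", OF _ mem'(1)],
        rule bexI[where x = "scaleC b g", OF _ mem'(2)], rule conjI[OF unit(1)],
        rule conjI[OF unit(2)], rule det)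
  then show "z \<in> (\<Union>M\<^sub>1\<in>{M. bounded_clinear M \<and> onorm M < \<epsilon>}.
      \<Union>M\<^sub>2\<in>{M. bounded_clinear M \<and> onorm M < \<epsilon>}.
      quad_num_range \<Omega> (\<lambda>z. mat_plus (L z) (map_prod M\<^sub>1 M\<^sub>2)))"
    by (rule UN_I[where a = ?M, rotated, OF UN_I[where a = ?N, rotated]])
      (use small bounded_clinear_scaleC in auto)
qed

section \<open>Pairs of vectors with vanishing perturbed determinant\<close>

lemma dense_imp_nonzero_mem:
  assumes "closure S = (UNIV :: 'a::real_normed_vector set)" "(UNIV :: 'a set) \<noteq> {0}"
  obtains x where "x \<in> S" "x \<noteq> 0"
proof -
  have "\<not> S \<subseteq> {0}"
    using closure_minimal[of S "{0}"] assms by auto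
  then show ?thesis using that by blast
qed

text \<open>For h = D^-1 C f and \<mu> = - (S f, f), where S is the Schur complement, (A f, f) +
  \<mu> = (B h, f) and D h = C f, so the condition holds for the pair \<open>f\<close>,
  \<open>h\<close> with \<nu> = 0. Replacing the second vector by its negative changes neither
  product, so \<open>h\<close> serves as well as - D^-1 C f.\<close>

lemma approx_null_schur1_imp_diag:
  fixes L :: "complex \<Rightarrow> ('a::complex_inner, 'b::complex_inner) opmat"
  assumes z: "z \<in> \<Omega>"
    and lin: "op_linear (ent11 (L z))" "op_linear (ent12 (L z))" "op_linear (ent21 (L z))"
      "op_linear (ent22 (L z))"
    and bij: "bij_betw (opapp (ent22 (L z))) (opdom (ent22 (L z))) UNIV"
    and dense: "closure (mat_dom2 (L z)) = UNIV" and nz: "(UNIV :: 'b set) \<noteq> {0}"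
    and null: "approx_null (schur1 (L z))"
  shows "z \<in> pseudo_quad_num_range_diag \<Omega> L"
proof (rule pseudo_quad_num_range_diagI[where z = z and L = L, OF z lin])
  fix \<epsilon> :: real assume "\<epsilon> > 0"
  then obtain f where f: "f \<in> opdom (schur1 (L z))" "norm f = 1"
      "cmod (cinner (opapp (schur1 (L z)) f) f) < \<epsilon>"
    using approx_null_imp_form_null[OF null] by (auto simp: form_null_def)
  define \<mu> where "\<mu> = - cinner (opapp (schur1 (L z)) f) f"
  define h where "h = op_inv (ent22 (L z)) (opapp (ent21 (L z)) f)"
  have h: "h \<in> opdom (ent22 (L z))" "opapp (ent22 (L z)) h = opapp (ent21 (L z)) f"
    unfolding h_def using op_inv_right[OF bij] by auto
  have f1: "f \<in> mat_dom1 (L z)" and h2: "h \<in> mat_dom2 (L z)"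
    using f(1) h by (auto simp: schur1_def h_def mat_dom2_def)
  have "opapp (schur1 (L z)) f = opapp (ent11 (L z)) f - opapp (ent12 (L z)) h"
    by (simp add: schur1_def h_def)
  then have a: "cinner (opapp (ent11 (L z)) f) f + \<mu> * cinner f f = cinner (opapp (ent12 (L z)) h) f"
    using f(2) by (simp add: \<mu>_def cinner_diff_left cinner_self)
  obtain g where g: "g \<in> mat_dom2 (L z)" "g \<noteq> 0"
    "cinner (opapp (ent12 (L z)) h) f * cinner (opapp (ent22 (L z)) g) g =
      cinner (opapp (ent12 (L z)) g) f * cinner (opapp (ent21 (L z)) f) g"
  \<comment> \<open>The vector \<open>h\<close> is admissible unless it is 0. In that case C f = D h
    = 0 and B h = 0, both sides vanish for every \<open>g\<close>, and density supplies a nonzero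
    one.\<close>
  proof (cases "h = 0")
    case True
    have z0: "opapp T 0 = 0" if "op_linear T" "0 \<in> opdom T" for T :: "('b, 'c::complex_inner) oper"
      using op_linear_scaleC[OF that, of 0] by simp
    obtain g where "g \<in> mat_dom2 (L z)" "g \<noteq> 0"
      using dense_imp_nonzero_mem[OF dense nz] by blast
    moreover have "opapp (ent12 (L z)) h = 0" "opapp (ent21 (L z)) f = 0"
      using True h h2 z0[OF lin(2)] z0[OF lin(4)] by (auto simp: mat_dom2_def)
    ultimately show ?thesis using that by simp
  next
    case False
    then show ?thesis using that[of h] h h2 by simp
  qed
  have "f \<noteq> 0" "cmod \<mu> < \<epsilon>" using f by (auto simp: \<mu>_def)
  then show "\<exists>\<mu> \<nu>. \<exists>f\<in>mat_dom1 (L z). \<exists>g\<in>mat_dom2 (L z).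
      cmod \<mu> < \<epsilon> \<and> cmod \<nu> < \<epsilon> \<and> f \<noteq> 0 \<and> g \<noteq> 0 \<and>
      (cinner (opapp (ent11 (L z)) f) f + \<mu> * cinner f f) *
      (cinner (opapp (ent22 (L z)) g) g + \<nu> * cinner g g) =
      cinner (opapp (ent12 (L z)) g) f * cinner (opapp (ent21 (L z)) f) g"
    using f1 g a \<open>\<epsilon> > 0\<close>
    by (intro exI[of _ \<mu>] exI[of _ 0] bexI[of _ f] bexI[of _ g]) auto
qed

text \<open>An independent set in the span of one vector has at most one element. The vector
  \<open>b\<close> may be 0, which covers the trivial space.\<close>

lemma cdim_le_1:
  fixes b :: "'a::complex_vector"
  assumes "\<And>x. \<exists>c. x = scaleC c b"
  shows "cdim TYPE('a) \<le> 1"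
  unfolding cdim_def
proof (rule SUP_least)
  fix S :: "'a set" assume "S \<in> {S. finite S \<and> cvec.independent S}"
  then have S: "finite S" "cvec.independent S" by auto
  have "S \<subseteq> cvec.span {b}"
    using assms by (auto simp: cvec.span_singleton)
  then have "card S \<le> card {b}"
    using cvec.independent_span_bound[OF _ S(2)] by blast
  then show "enat (card S) \<le> 1" by (simp add: one_enat_def)
qed

text \<open>If 0 were the only vector of \<open>S\<close> orthogonal to \<open>b\<close>, then (y,
  b) x - (x, b) y, which is orthogonal to \<open>b\<close>, would vanish for x, y in
  \<open>S\<close> and by density for all x, y. Taking y = b makes every x a multiple of
  \<open>b\<close>, so the dimension is at most 1.\<close>

lemma dense_subspace_orthogonal:
  fixes b :: "'a::complex_inner"
  assumes sub: "cvec.subspace S" and dense: "closure S = UNIV" and dim: "cdim TYPE('a) > 1"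
  obtains f where "f \<in> S" "f \<noteq> 0" "cinner b f = 0"
proof -
  note * = that
  have nz: "(UNIV :: 'a set) \<noteq> {0}"
  proof
    assume "(UNIV :: 'a set) = {0}"
    then have "\<exists>c. x = scaleC c (0::'a)" for x by auto
    then show False using cdim_le_1[where 'a = 'a] dim by (metis leD)
  qed
  show ?thesis
  proof (rule ccontr)
    assume contr: "\<not> thesis"
    then have none: "f = 0" if "f \<in> S" "cinner f b = 0" for f
      using that *[of f] contr by (metis cinner_commute complex_cnj_zero)
    \<comment> \<open>For b = 0 every vector of \<open>S\<close> would be orthogonal to
      \<open>b\<close>, and \<open>S\<close> contains a nonzero one.\<close>
    have "b \<noteq> 0"
      using dense_imp_nonzero_mem[OF dense nz] none by (metis cinner_zero_right)
    let ?F = "\<lambda>x y. scaleC (cinner y b) x - scaleC (cinner x b) y"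
    have closed1: "closed {x. ?F x y = 0}" and closed2: "closed {y. ?F x y = 0}" for x y
      by (intro closed_Collect_eq continuous_intros linear_continuous_on bounded_linear_scaleC
          bounded_linear_compose[OF bounded_linear_scaleC_left bounded_linear_cinner_left])+
    have "?F x y = 0" if "x \<in> S" "y \<in> S" for x y
      using that sub
      by (intro none cvec.subspace_diff cvec.subspace_scale)
        (auto simp: cinner_diff_left cinner_scaleC_left)
    \<comment> \<open>Density is applied in one variable at a time, first in x and then in
      y.\<close>
    then have "?F x y = 0" if "y \<in> S" for x y
      using closure_minimal[OF _ closed1, of S y] dense that by blast
    then have F: "?F x y = 0" for x y
      using closure_minimal[OF _ closed2, of S x] dense by blast
    have "x = scaleC (cinner x b / cinner b b) b" for x
    proof -
      have "scaleC (inverse (cinner b b)) (scaleC (cinner b b) x)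
          = scaleC (inverse (cinner b b)) (scaleC (cinner x b) b)"
        using F[of x b] by simp
      then show ?thesis
        using \<open>b \<noteq> 0\<close> by (simp add: scaleC_scaleC cinner_self scaleC_one divide_inverse mult.commute)
    qed
    then have "cdim TYPE('a) \<le> 1" by (intro cdim_le_1) blast
    with dim show False by simp
  qed
qed

text \<open>The choice \<nu> = - (D g, g) annihilates the second diagonal factor, and
  \<open>f\<close> orthogonal to B g annihilates the off-diagonal product, so the first block can
  stay unperturbed.\<close>

lemma form_null_imp_diag:
  fixes L :: "complex \<Rightarrow> ('a::complex_inner, 'b::complex_inner) opmat"
  assumes z: "z \<in> \<Omega>"
    and lin: "op_linear (ent11 (L z))" "op_linear (ent12 (L z))" "op_linear (ent21 (L z))"
      "op_linear (ent22 (L z))"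
    and dom: "opdom (ent22 (L z)) \<subseteq> opdom (ent12 (L z))"
    and dense: "closure (mat_dom1 (L z)) = UNIV" and dim: "cdim TYPE('a) > 1"
    and null: "form_null (ent22 (L z))"
  shows "z \<in> pseudo_quad_num_range_diag \<Omega> L"
proof (rule pseudo_quad_num_range_diagI[where z = z and L = L, OF z lin])
  fix \<epsilon> :: real assume "\<epsilon> > 0"
  then obtain g where g: "g \<in> opdom (ent22 (L z))" "norm g = 1"
      "cmod (cinner (opapp (ent22 (L z)) g) g) < \<epsilon>"
    using null by (auto simp: form_null_def)
  have "cvec.subspace (mat_dom1 (L z))"
    unfolding mat_dom1_def using lin by (intro cvec.subspace_inter op_linear_subspace)
  then obtain f where f: "f \<in> mat_dom1 (L z)" "f \<noteq> 0" "cinner (opapp (ent12 (L z)) g) f = 0"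
    using dense_subspace_orthogonal[OF _ dense dim] by blast
  have "g \<in> mat_dom2 (L z)" "g \<noteq> 0" using g dom by (auto simp: mat_dom2_def)
  then show "\<exists>\<mu> \<nu>. \<exists>f\<in>mat_dom1 (L z). \<exists>g\<in>mat_dom2 (L z).
      cmod \<mu> < \<epsilon> \<and> cmod \<nu> < \<epsilon> \<and> f \<noteq> 0 \<and> g \<noteq> 0 \<and>
      (cinner (opapp (ent11 (L z)) f) f + \<mu> * cinner f f) *
      (cinner (opapp (ent22 (L z)) g) g + \<nu> * cinner g g) =
      cinner (opapp (ent12 (L z)) g) f * cinner (opapp (ent21 (L z)) f) g"
    using f g \<open>\<epsilon> > 0\<close>
    by (intro exI[of _ 0] exI[of _ "- cinner (opapp (ent22 (L z)) g) g"] bexI[of _ f] bexI[of _ g])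
      (auto simp: cinner_self)
qed

section \<open>Block diagonal perturbations\<close>

lemma bounded_clinear_map_prod:
  assumes "bounded_clinear M" "bounded_clinear N"
  shows "bounded_clinear (map_prod M N)"
proof -
  have bl: "bounded_linear M" "bounded_linear N" using assms by (auto simp: bounded_clinear_def)
  have "bounded_linear (\<lambda>x. (M (fst x), N (snd x)))"
    by (intro bounded_linear_Pair bounded_linear_compose[OF bl(1) bounded_linear_fst]
        bounded_linear_compose[OF bl(2) bounded_linear_snd])
  then show ?thesis
    using assms by (auto simp: bounded_clinear_def scaleC_prod_def map_prod_def case_prod_beta')
qed

lemma onorm_map_prod_le:
  assumes "bounded_linear M" "bounded_linear N"
  shows "onorm (map_prod M N) \<le> max (onorm M) (onorm N)"
proof (rule onorm_bound)
  let ?m = "max (onorm M) (onorm N)"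
  show m: "?m \<ge> 0" using onorm_pos_le[OF assms(1)] by simp
  fix x
  have "norm (M (fst x)) \<le> ?m * norm (fst x)" "norm (N (snd x)) \<le> ?m * norm (snd x)"
    using onorm[OF assms(1), of "fst x"] onorm[OF assms(2), of "snd x"]
    by (meson max.cobounded1 max.cobounded2 mult_right_mono norm_ge_zero order_trans)+
  then have "norm (map_prod M N x) \<le> sqrt ((?m * norm (fst x))\<^sup>2 + (?m * norm (snd x))\<^sup>2)"
    by (auto simp: norm_prod_def intro!: add_mono power_mono)
  also have "\<dots> = ?m * norm x"
    using m by (simp add: norm_prod_def power_mult_distrib distrib_left[symmetric] real_sqrt_mult)
  finally show "norm (map_prod M N x) \<le> ?m * norm x" .
qed

text \<open>Two blocks of norm below \<epsilon> form a bounded operator on the direct sum whose norm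
  is at most their maximum, hence again below \<epsilon>.\<close>

lemma pseudo_quad_num_range_diag_subset:
  "pseudo_quad_num_range_diag \<Omega> L \<subseteq> pseudo_quad_num_range \<Omega> L"
proof -
  have "bounded_clinear (map_prod M N) \<and> onorm (map_prod M N) < \<epsilon>"
    if "bounded_clinear M" "onorm M < \<epsilon>" "bounded_clinear N" "onorm N < \<epsilon>"
    for M :: "'a \<Rightarrow> 'a" and N :: "'b \<Rightarrow> 'b" and \<epsilon>
    using bounded_clinear_map_prod[OF that(1,3)] onorm_map_prod_le[of M N] that
    by (auto simp: bounded_clinear_def)
  then show ?thesis
    unfolding pseudo_quad_num_range_diag_def pseudo_quad_num_range_def by blast
qed

text \<open>Both conclusions rest on one alternative: the Schur complement has approximate null
  vectors, or 0 lies in the closure of the numerical range of the lower right entry. The hypotheses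
  concern a single point \<open>z\<close>.\<close>

lemma schur1_inclusions:
  fixes L :: "complex \<Rightarrow> ('a::complex_inner, 'b::complex_inner) opmat" and p s :: complex
  assumes z: "z \<in> fam_ap_spectrum \<Omega> (\<lambda>z. mat_op (L z)) - fam_spectrum \<Omega> (\<lambda>z. ent22 (L z))"
    and sign: "s = 1 \<or> s = -1" "p = 1 \<or> p = -1"
    and lin: "op_linear (ent11 (L z))" "op_linear (ent12 (L z))" "op_linear (ent21 (L z))"
      "op_linear (ent22 (L z))"
    and adj: "\<And>f g. f \<in> opdom (ent21 (L z)) \<Longrightarrow> g \<in> opdom (ent12 (L z)) \<Longrightarrow>
        cinner (opapp (ent21 (L z)) f) g = s * cnj (cinner (opapp (ent12 (L z)) g) f)"
    and acc: "accretive (op_scale p (ent11 (L z)))"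
    and sec: "sectorial0 (op_scale (- s * p) (ent22 (L z)))"
    and rel: "rel_bounded (ent12 (L z)) (ent22 (L z))"
  shows "z \<in> fam_ap_spectrum (fam_resolvent \<Omega> (\<lambda>z. ent22 (L z))) (\<lambda>z. schur1 (L z)) \<union>
      pseudo_num_range \<Omega> (\<lambda>z. ent22 (L z))"
    and "(UNIV :: 'b set) \<noteq> {0} \<Longrightarrow> closure (mat_dom1 (L z)) = UNIV \<Longrightarrow>
      closure (mat_dom2 (L z)) = UNIV \<Longrightarrow> cdim TYPE('a) > 1 \<Longrightarrow> z \<in> pseudo_quad_num_range_diag \<Omega> L"
proof -
  have z\<Omega>: "z \<in> \<Omega>" and null: "approx_null (mat_op (L z))"
    and res: "z \<in> fam_resolvent \<Omega> (\<lambda>z. ent22 (L z))"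
    using z by (auto simp: fam_ap_spectrum_iff fam_resolvent_def)
  note bij = fam_resolventD(2,3)[OF res]
  have alt: "approx_null (schur1 (L z)) \<or> form_null (ent22 (L z))"
    by (rule approx_null_mat_op[OF sign lin adj acc sec rel bij null])
  then show "z \<in> fam_ap_spectrum (fam_resolvent \<Omega> (\<lambda>z. ent22 (L z))) (\<lambda>z. schur1 (L z)) \<union>
      pseudo_num_range \<Omega> (\<lambda>z. ent22 (L z))"
    using z\<Omega> res form_null_imp_pseudo_num_range[where T = "\<lambda>z. ent22 (L z)"]
    by (auto simp: fam_ap_spectrum_iff)
  assume nz: "(UNIV :: 'b set) \<noteq> {0}"
    and dense: "closure (mat_dom1 (L z)) = UNIV" "closure (mat_dom2 (L z)) = UNIV"
    and dim: "cdim TYPE('a) > 1"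
  have "opdom (ent22 (L z)) \<subseteq> opdom (ent12 (L z))" using rel by (simp add: rel_bounded_def)
  with alt show "z \<in> pseudo_quad_num_range_diag \<Omega> L"
    using approx_null_schur1_imp_diag[where z = z and L = L, OF z\<Omega> lin bij(1) dense(2) nz]
      form_null_imp_diag[where z = z and L = L, OF z\<Omega> lin _ dense(1) dim] by blast
qed

section \<open>Interchanging the two components\<close>

text \<open>The sign \<open>p\<close> in the preceding lemmas is there for this interchange: in part (ii) the operator
  multiplied by \<open>- s\<close> is the one that moves to the upper left corner.\<close>

definition swap_mat :: "('a, 'b) opmat \<Rightarrow> ('b, 'a) opmat" where
  "swap_mat L = OpMat (ent22 L) (ent21 L) (ent12 L) (ent11 L)"

lemma swap_mat_sel [simp]:
  "ent11 (swap_mat L) = ent22 L" "ent12 (swap_mat L) = ent21 L"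
  "ent21 (swap_mat L) = ent12 L" "ent22 (swap_mat L) = ent11 L"
  "mat_dom1 (swap_mat L) = mat_dom2 L" "mat_dom2 (swap_mat L) = mat_dom1 L"
  by (auto simp: swap_mat_def mat_dom1_def mat_dom2_def)

lemma schur1_swap_mat: "schur1 (swap_mat L) = schur2 L"
  by (simp add: schur1_def schur2_def)

text \<open>Interchanging the two coordinates is isometric and carries one matrix operator to the
  other.\<close>

lemma approx_null_swap_mat:
  assumes "approx_null (mat_op L)"
  shows "approx_null (mat_op (swap_mat L))"
  unfolding approx_null_def
proof (intro allI impI)
  fix \<epsilon> :: real assume "\<epsilon> > 0"
  then obtain f g where "(f, g) \<in> opdom (mat_op L)" "norm (f, g) = 1"
      "norm (opapp (mat_op L) (f, g)) < \<epsilon>"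
    using assms unfolding approx_null_def by force
  then show "\<exists>x\<in>opdom (mat_op (swap_mat L)). norm x = 1 \<and> norm (opapp (mat_op (swap_mat L)) x) < \<epsilon>"
    by (intro bexI[of _ "(g, f)"]) (auto simp: mat_op_def norm_Pair add.commute)
qed

text \<open>Interchanging both the rows and the columns leaves a 2 x 2 determinant
  unchanged.\<close>

lemma quad_num_range_swap_mat: "quad_num_range \<Omega> (\<lambda>z. swap_mat (L z)) = quad_num_range \<Omega> L"
  unfolding quad_num_range_def by (auto simp: det_2 mult.commute)

lemma mat_plus_swap_mat:
  "mat_plus (swap_mat L) (map_prod N M) = swap_mat (mat_plus L (map_prod M N))"
  by (simp add: mat_plus_def swap_mat_def)

lemma pseudo_quad_num_range_diag_swap_mat:
  "pseudo_quad_num_range_diag \<Omega> (\<lambda>z. swap_mat (L z)) = pseudo_quad_num_range_diag \<Omega> L"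
  unfolding pseudo_quad_num_range_diag_def mat_plus_swap_mat quad_num_range_swap_mat by blast

text \<open>The choice of signs is encoded by \<open>s\<close>: the upper signs are
  \<open>s = 1\<close>, the lower ones \<open>s = -1\<close>, and the opposite sign in front of D is
  the factor \<open>- s\<close>.\<close>

theorem theorem5p3:
  fixes \<Omega> :: "complex set" and s :: complex
    and A :: "complex \<Rightarrow> ('h1::complex_hilbert, 'h1) oper"
    and B :: "complex \<Rightarrow> ('h2::complex_hilbert, 'h1) oper"
    and C :: "complex \<Rightarrow> ('h1, 'h2) oper"
    and D :: "complex \<Rightarrow> ('h2, 'h2) oper"
    and L :: "complex \<Rightarrow> ('h1, 'h2) opmat"
  assumes nonzero1: "(UNIV :: 'h1 set) \<noteq> {0}"
    and nonzero2: "(UNIV :: 'h2 set) \<noteq> {0}"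
    and domain: "open \<Omega>" "connected \<Omega>" "\<Omega> \<noteq> {}"
    and A: "\<And>z. z \<in> \<Omega> \<Longrightarrow> op_linear (A z) \<and> densely_defined (A z) \<and> closable (A z)"
    and B: "\<And>z. z \<in> \<Omega> \<Longrightarrow> op_linear (B z) \<and> densely_defined (B z) \<and> closable (B z)"
    and C: "\<And>z. z \<in> \<Omega> \<Longrightarrow> op_linear (C z) \<and> densely_defined (C z) \<and> closable (C z)"
    and D: "\<And>z. z \<in> \<Omega> \<Longrightarrow> op_linear (D z) \<and> densely_defined (D z) \<and> closable (D z)"
    and L: "\<And>z. L z = OpMat (A z) (B z) (C z) (D z)"
    and dense: "\<And>z. z \<in> \<Omega> \<Longrightarrow> densely_defined (mat_op (L z))"
    and sign: "s = 1 \<or> s = -1"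
  shows
    "((\<forall>z \<in> fam_ap_spectrum \<Omega> (\<lambda>z. mat_op (L z)) - fam_spectrum \<Omega> D.
         op_subset (C z) (op_scale s (op_adj (B z))) \<and> accretive (A z) \<and>
         sectorial0 (op_scale (- s) (D z)) \<and> rel_bounded (B z) (D z) \<longrightarrow>
         z \<in> fam_ap_spectrum (fam_resolvent \<Omega> D) (\<lambda>z. schur1 (L z)) \<union> pseudo_num_range \<Omega> D) \<and>
      ((\<forall>z \<in> fam_resolvent \<Omega> D.
         op_subset (C z) (op_scale s (op_adj (B z))) \<and> accretive (A z) \<and>
         sectorial0 (op_scale (- s) (D z)) \<and> rel_bounded (B z) (D z)) \<longrightarrow>
       fam_ap_spectrum \<Omega> (\<lambda>z. mat_op (L z)) - fam_spectrum \<Omega> D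
         \<subseteq> fam_ap_spectrum (fam_resolvent \<Omega> D) (\<lambda>z. schur1 (L z)) \<union> pseudo_num_range \<Omega> D \<and>
       fam_ap_spectrum (fam_resolvent \<Omega> D) (\<lambda>z. schur1 (L z)) \<union> pseudo_num_range \<Omega> D
         \<subseteq> pseudo_num_range (fam_resolvent \<Omega> D) (\<lambda>z. schur1 (L z)) \<union> pseudo_num_range \<Omega> D \<and>
       (cdim TYPE('h1) > 1 \<longrightarrow>
         fam_ap_spectrum \<Omega> (\<lambda>z. mat_op (L z)) - fam_spectrum \<Omega> D
           \<subseteq> pseudo_quad_num_range_diag \<Omega> L \<and>
         pseudo_quad_num_range_diag \<Omega> L \<subseteq> pseudo_quad_num_range \<Omega> L)))
     \<and>
     ((\<forall>z \<in> fam_ap_spectrum \<Omega> (\<lambda>z. mat_op (L z)) - fam_spectrum \<Omega> A.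
         op_subset (C z) (op_scale s (op_adj (B z))) \<and> sectorial0 (A z) \<and>
         accretive (op_scale (- s) (D z)) \<and> rel_bounded (C z) (A z) \<longrightarrow>
         z \<in> fam_ap_spectrum (fam_resolvent \<Omega> A) (\<lambda>z. schur2 (L z)) \<union> pseudo_num_range \<Omega> A) \<and>
      ((\<forall>z \<in> fam_resolvent \<Omega> A.
         op_subset (C z) (op_scale s (op_adj (B z))) \<and> sectorial0 (A z) \<and>
         accretive (op_scale (- s) (D z)) \<and> rel_bounded (C z) (A z)) \<longrightarrow>
       fam_ap_spectrum \<Omega> (\<lambda>z. mat_op (L z)) - fam_spectrum \<Omega> A
         \<subseteq> fam_ap_spectrum (fam_resolvent \<Omega> A) (\<lambda>z. schur2 (L z)) \<union> pseudo_num_range \<Omega> A \<and>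
       fam_ap_spectrum (fam_resolvent \<Omega> A) (\<lambda>z. schur2 (L z)) \<union> pseudo_num_range \<Omega> A
         \<subseteq> pseudo_num_range (fam_resolvent \<Omega> A) (\<lambda>z. schur2 (L z)) \<union> pseudo_num_range \<Omega> A \<and>
       (cdim TYPE('h2) > 1 \<longrightarrow>
         fam_ap_spectrum \<Omega> (\<lambda>z. mat_op (L z)) - fam_spectrum \<Omega> A
           \<subseteq> pseudo_quad_num_range_diag \<Omega> L \<and>
         pseudo_quad_num_range_diag \<Omega> L \<subseteq> pseudo_quad_num_range \<Omega> L)))"
proof -
  have ents [simp]: "ent11 (L z) = A z" "ent12 (L z) = B z" "ent21 (L z) = C z" "ent22 (L z) = D z" for z
    by (simp_all add: L)
  have lin: "op_linear (A z)" "op_linear (B z)" "op_linear (C z)" "op_linear (D z)" if "z \<in> \<Omega>" for z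
    using that A B C D by auto
  \<comment> \<open>The closure of a product is the product of the closures, so density of the
    domain of the matrix passes to both factors.\<close>
  have dense12: "closure (mat_dom1 (L z)) = UNIV" "closure (mat_dom2 (L z)) = UNIV" if "z \<in> \<Omega>" for z
  proof -
    have "closure (mat_dom1 (L z)) \<times> closure (mat_dom2 (L z)) = UNIV"
      using dense[OF that] by (simp add: densely_defined_def mat_op_def closure_Times)
    then show "closure (mat_dom1 (L z)) = UNIV" "closure (mat_dom2 (L z)) = UNIV" by auto
  qed
  have adj: "cinner (opapp (C z) f) g = s * cnj (cinner (opapp (B z) g) f)"
    if "z \<in> \<Omega>" "op_subset (C z) (op_scale s (op_adj (B z)))" "f \<in> opdom (C z)" "g \<in> opdom (B z)" for z f g
    using op_subset_scale_adj that B by blast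
  \<comment> \<open>As \<open>s\<close> is real with \<open>s * s = 1\<close>, conjugation solves
    the identity for B; on the respective domains the relation is symmetric in B and C.\<close>
  have adj': "cinner (opapp (B z) g) f = s * cnj (cinner (opapp (C z) f) g)"
    if "z \<in> \<Omega>" "op_subset (C z) (op_scale s (op_adj (B z)))" "g \<in> opdom (B z)" "f \<in> opdom (C z)" for z f g
    using adj[OF that(1,2,4,3)] sign by auto
  have scale1: "op_scale 1 T = T" for T :: "('h1, 'h1) oper"
    by (cases T) (simp add: op_scale_def scaleC_one)
  \<comment> \<open>\<open>P\<close> and \<open>Q\<close> collect the hypotheses of the two parts at
    a single point; the pointwise claims and the inclusions that depend on them reduce to
    \<open>i\<close> and \<open>ii\<close>.\<close>
  define P where "P z \<longleftrightarrow> op_subset (C z) (op_scale s (op_adj (B z))) \<and> accretive (A z) \<and>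
      sectorial0 (op_scale (- s) (D z)) \<and> rel_bounded (B z) (D z)" for z
  define Q where "Q z \<longleftrightarrow> op_subset (C z) (op_scale s (op_adj (B z))) \<and> sectorial0 (A z) \<and>
      accretive (op_scale (- s) (D z)) \<and> rel_bounded (C z) (A z)" for z
  have i: "z \<in> fam_ap_spectrum (fam_resolvent \<Omega> D) (\<lambda>z. schur1 (L z)) \<union> pseudo_num_range \<Omega> D"
    "cdim TYPE('h1) > 1 \<Longrightarrow> z \<in> pseudo_quad_num_range_diag \<Omega> L"
    if z: "z \<in> fam_ap_spectrum \<Omega> (\<lambda>z. mat_op (L z)) - fam_spectrum \<Omega> D" and "P z" for z
  proof -
    have z\<Omega>: "z \<in> \<Omega>" using z by (auto simp: fam_ap_spectrum_iff)
    note * = schur1_inclusions[where L = L and p = 1 and s = s,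
        unfolded ents mult_1_right scale1, OF z sign disjI1[OF refl] lin[OF z\<Omega>]]
    have "\<And>f g. f \<in> opdom (C z) \<Longrightarrow> g \<in> opdom (B z) \<Longrightarrow>
        cinner (opapp (C z) f) g = s * cnj (cinner (opapp (B z) g) f)"
      using adj[OF z\<Omega>] \<open>P z\<close> by (simp add: P_def)
    note ** = *[OF this]
    show "z \<in> fam_ap_spectrum (fam_resolvent \<Omega> D) (\<lambda>z. schur1 (L z)) \<union> pseudo_num_range \<Omega> D"
      "cdim TYPE('h1) > 1 \<Longrightarrow> z \<in> pseudo_quad_num_range_diag \<Omega> L"
      using ** \<open>P z\<close> dense12[OF z\<Omega>] nonzero2 unfolding P_def by blast+
  qed
  have ii: "z \<in> fam_ap_spectrum (fam_resolvent \<Omega> A) (\<lambda>z. schur2 (L z)) \<union> pseudo_num_range \<Omega> A"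
    "cdim TYPE('h2) > 1 \<Longrightarrow> z \<in> pseudo_quad_num_range_diag \<Omega> L"
    if z: "z \<in> fam_ap_spectrum \<Omega> (\<lambda>z. mat_op (L z)) - fam_spectrum \<Omega> A" and "Q z" for z
  proof -
    have z\<Omega>: "z \<in> \<Omega>" using z by (auto simp: fam_ap_spectrum_iff)
    have z': "z \<in> fam_ap_spectrum \<Omega> (\<lambda>z. mat_op (swap_mat (L z))) - fam_spectrum \<Omega> A"
      using z by (auto simp: fam_ap_spectrum_iff approx_null_swap_mat)
    \<comment> \<open>With p = - s the operator required to be accretive in the upper left corner is
      - s D, and - s * p = 1 leaves A itself as the sectorial one.\<close>
    have ss: "- s * - s = 1" "- s = 1 \<or> - s = -1" using sign by auto
    note * = schur1_inclusions[where L = "\<lambda>z. swap_mat (L z)" and p = "- s" and s = s,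
        unfolded swap_mat_sel ents ss(1) scale1 schur1_swap_mat pseudo_quad_num_range_diag_swap_mat,
        OF z' sign ss(2) lin(4,3,2,1)[OF z\<Omega>]]
    have "\<And>f g. f \<in> opdom (B z) \<Longrightarrow> g \<in> opdom (C z) \<Longrightarrow>
        cinner (opapp (B z) f) g = s * cnj (cinner (opapp (C z) g) f)"
      using adj'[OF z\<Omega>] \<open>Q z\<close> by (simp add: Q_def)
    note ** = *[OF this]
    show "z \<in> fam_ap_spectrum (fam_resolvent \<Omega> A) (\<lambda>z. schur2 (L z)) \<union> pseudo_num_range \<Omega> A"
      "cdim TYPE('h2) > 1 \<Longrightarrow> z \<in> pseudo_quad_num_range_diag \<Omega> L"
      using ** \<open>Q z\<close> dense12[OF z\<Omega>] nonzero1 unfolding Q_def by blast+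
  qed
  \<comment> \<open>Points of the approximate point spectrum lie in \<Omega>; those outside the
    spectrum of D are therefore in its resolvent set, where the hypotheses are assumed.\<close>
  have res: "z \<in> fam_resolvent \<Omega> D"
    if "z \<in> fam_ap_spectrum \<Omega> (\<lambda>z. mat_op (L z)) - fam_spectrum \<Omega> D" for z
    using that by (auto simp: fam_resolvent_def fam_ap_spectrum_iff)
  have res': "z \<in> fam_resolvent \<Omega> A"
    if "z \<in> fam_ap_spectrum \<Omega> (\<lambda>z. mat_op (L z)) - fam_spectrum \<Omega> A" for z
    using that by (auto simp: fam_resolvent_def fam_ap_spectrum_iff)
  show ?thesis
    unfolding P_def[symmetric] Q_def[symmetric]
  proof (intro conjI ballI impI)
    fix z assume "z \<in> fam_ap_spectrum \<Omega> (\<lambda>z. mat_op (L z)) - fam_spectrum \<Omega> D" "P z"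
    then show "z \<in> fam_ap_spectrum (fam_resolvent \<Omega> D) (\<lambda>z. schur1 (L z)) \<union> pseudo_num_range \<Omega> D"
      by (rule i)
  next
    assume P: "\<forall>z\<in>fam_resolvent \<Omega> D. P z"
    show "fam_ap_spectrum \<Omega> (\<lambda>z. mat_op (L z)) - fam_spectrum \<Omega> D
      \<subseteq> fam_ap_spectrum (fam_resolvent \<Omega> D) (\<lambda>z. schur1 (L z)) \<union> pseudo_num_range \<Omega> D"
      using i(1) res P by blast
    show "fam_ap_spectrum \<Omega> (\<lambda>z. mat_op (L z)) - fam_spectrum \<Omega> D \<subseteq> pseudo_quad_num_range_diag \<Omega> L"
      if "cdim TYPE('h1) > 1"
      using i(2) res P that by blast
  next
    fix z assume "z \<in> fam_ap_spectrum \<Omega> (\<lambda>z. mat_op (L z)) - fam_spectrum \<Omega> A" "Q z"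
    then show "z \<in> fam_ap_spectrum (fam_resolvent \<Omega> A) (\<lambda>z. schur2 (L z)) \<union> pseudo_num_range \<Omega> A"
      by (rule ii)
  next
    assume Q: "\<forall>z\<in>fam_resolvent \<Omega> A. Q z"
    show "fam_ap_spectrum \<Omega> (\<lambda>z. mat_op (L z)) - fam_spectrum \<Omega> A
      \<subseteq> fam_ap_spectrum (fam_resolvent \<Omega> A) (\<lambda>z. schur2 (L z)) \<union> pseudo_num_range \<Omega> A"
      using ii(1) res' Q by blast
    show "fam_ap_spectrum \<Omega> (\<lambda>z. mat_op (L z)) - fam_spectrum \<Omega> A \<subseteq> pseudo_quad_num_range_diag \<Omega> L"
      if "cdim TYPE('h2) > 1"
      using ii(2) res' Q that by blast
  \<comment> \<open>Left over in both parts are the passages from the approximate point spectrum to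
    the pseudo numerical range and from block diagonal to general perturbations.\<close>
  qed (intro Un_mono ap_spectrum_subset_pseudo_num_range order_refl pseudo_quad_num_range_diag_subset)+
qed

end
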